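(* If the sum vector of a scroll on $n\ge4$ vertices has period $\lambda$, then $\lambda\mid n$ and $n\ge 4\lambda$.
   Context: Let $\mathcal{C}_n$ be the cycle graph on $\mathbb{Z}_n=\{1,\dots,n\}$ with edges $\{i,i+1\}$ (mod $n$). Independent sets are binary vectors $x\in\{0,1\}^n$ with no two cyclically adjacent $1$s. The toggle $\tau_k$ changes $x_k$ from $1$ to $0$, from $0$ to $1$ if the result is independent, and otherwise does nothing; $\tau=\tau_n\circ\cdots\circ\tau_1$, $x^{(i)}=\tau^i(x)$. The scroll (on $n$ vertices) of $x$ is the array whose $i$-th row ($i\in\mathbb{Z}$) is $x^{(i)}$; its period $T$ is the least $m>0$ with $x^{(m)}=x$. Its sum vector is the vector in $\mathbb{N}^n$ of column sums of the table with rows $x^{(0)},\dots,x^{(T-1)}$, and its period is its period as a cyclic word: the least $\lambda>0$ with $\Sigma_{j+\lambda}=\Sigma_j$ for all $j$ (indices mod $n$). *)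

theory Defs
  imports Main "HOL-Library.FuncSet"
begin

text \<open>The vertices of the cycle graph are \<open>{1..n}\<close>; \<open>cyc n j\<close> is the representative in \<open>{1..n}\<close>
  of the residue class of \<open>j\<close> modulo \<open>n\<close>.\<close>

definition cyc :: "nat \<Rightarrow> nat \<Rightarrow> nat" where
  "cyc n j = (if j mod n = 0 then n else j mod n)"

definition cycle_edges :: "nat \<Rightarrow> nat set set" where
  "cycle_edges n = {{i, cyc n (i + 1)} | i. i \<in> {1..n}}"

text \<open>Vectors indexed by \<open>{1..n}\<close> are extensional functions, so that equality of functions is
  equality of vectors.\<close>

definition indep_sets :: "nat \<Rightarrow> (nat \<Rightarrow> nat) set" where
  "indep_sets n = {x \<in> {1..n} \<rightarrow>\<^sub>E {0, 1}.
     \<forall>i\<in>{1..n}. \<forall>j\<in>{1..n}. {i, j} \<in> cycle_edges n \<longrightarrow> \<not> (x i = 1 \<and> x j = 1)}"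

definition toggle :: "nat \<Rightarrow> nat \<Rightarrow> (nat \<Rightarrow> nat) \<Rightarrow> (nat \<Rightarrow> nat)" where
  "toggle n k x =
     (if x k = 1 then x(k := 0)
      else if x(k := 1) \<in> indep_sets n then x(k := 1)
      else x)"

text \<open>The toggle at vertex \<open>1\<close> is applied first.\<close>

definition tau :: "nat \<Rightarrow> (nat \<Rightarrow> nat) \<Rightarrow> (nat \<Rightarrow> nat)" where
  "tau n x = fold (toggle n) [1..<Suc n] x"

text \<open>For \<open>i < 0\<close> the row is obtained from the inverse of the permutation that \<open>tau n\<close> induces on
  \<open>indep_sets n\<close>.\<close>

definition scroll :: "nat \<Rightarrow> (nat \<Rightarrow> nat) \<Rightarrow> int \<Rightarrow> (nat \<Rightarrow> nat)" where
  "scroll n x i =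
     (if 0 \<le> i then (tau n ^^ nat i) x
      else (inv_into (indep_sets n) (tau n) ^^ nat (- i)) x)"

definition scroll_period :: "(int \<Rightarrow> nat \<Rightarrow> nat) \<Rightarrow> nat" where
  "scroll_period S = (LEAST m. 0 < m \<and> S (int m) = S 0)"

definition sum_vector :: "nat \<Rightarrow> (int \<Rightarrow> nat \<Rightarrow> nat) \<Rightarrow> nat \<Rightarrow> nat" where
  "sum_vector n S = (\<lambda>j\<in>{1..n}. \<Sum>i<scroll_period S. S (int i) j)"

definition cyclic_word_period :: "nat \<Rightarrow> (nat \<Rightarrow> 'a) \<Rightarrow> nat" where
  "cyclic_word_period n w = (LEAST p. 0 < p \<and> (\<forall>j\<in>{1..n}. w (cyc n (j + p)) = w j))"

end

(* Concatenating the rows of the scroll gives a tape X indexed by the integers with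
   X m = 1 iff X (m - n) = X (m - n + 1) = X (m - 1) = 0. Put u = 1 and v = n - 1. Every 1 at m has
   exactly one successor among m + 2u, m + 2u + v and exactly one predecessor among m - 2v, m - 2v - u,
   and the two kinds of steps commute, so all the 1s form a grid P i j =
   z + (2 i - D j) u + (E i - 2 j) v, where E and D increase by 0 or 1 at each step. Since
   (n - 1) u - v = 0, the grid returns: there are a, b with 2 a - D b = n - 1 and E a = 2 b - 1.
   Hence E is additively periodic with period a, so X is invariant under the shift by
   2 a + (n - 1) E a, which is congruent modulo n to N1 = 2 a - E a. So lambda divides n and N1, hence
   N2 = n - N1 = 2 b - D b. Here N1, N2 > 0, N1 is odd and N2 <= N1 + 1, which leaves only
   N1 = N2 = lambda to be excluded when n < 4 lambda; then all the steps of E are 1, X is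
   invariant under the shift by n + 1, and lambda divides 1. *)

theory Submission
  imports Defs
begin

section \<open>The grid of live entries\<close>


locale tape =
  fixes N :: int and X :: "int \<Rightarrow> bool"
  assumes N_ge: "2 \<le> N"
    and rec: "X m \<longleftrightarrow> \<not> X (m - N) \<and> \<not> X (m - N + 1) \<and> \<not> X (m - 1)"
begin

lemma not_adjacent:
  assumes "X m"
  shows "\<not> X (m + 1)" "\<not> X (m + N - 1)" "\<not> X (m + N)" "\<not> X (m - 1)" "\<not> X (m - N + 1)" "\<not> X (m - N)"
  using rec[of "m + 1"] rec[of "m + N - 1"] rec[of "m + N"] rec[of m] assms by auto

text \<open>In the recurrence at \<open>m + N + 1\<close> the entries \<open>m + 1\<close> and
  \<open>m + N\<close> are dead because \<open>m\<close> is live, so \<open>m + 2\<close> alone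
  decides.\<close>

lemma snake_succ:
  assumes "X m"
  shows "X (m + N + 1) \<longleftrightarrow> \<not> X (m + 2)"
  using rec[of "m + N + 1"] not_adjacent[OF assms] by (simp add: algebra_simps)

text \<open>The entry \<open>m - N + 1\<close> is dead although its left neighbour
  \<open>m - N\<close> is dead too, so one of the two candidates blocks it; being adjacent, they are
  not both live.\<close>

lemma cosnake_pred:
  assumes "X m"
  shows "X (m - 2 * N + 1) \<longleftrightarrow> \<not> X (m - 2 * N + 2)"
proof -
  have "\<not> X (m - N + 1)" "\<not> X (m - N)" using not_adjacent[OF assms] by auto
  then show ?thesis
    using rec[of "m - N + 1"] not_adjacent(1)[of "m - 2 * N + 1"] by (auto simp: algebra_simps)
qed

text \<open>If the fourth corner were dead, \<open>?r\<close> would have its other predecessor and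
  \<open>?s\<close> its other successor. Unless \<open>e = d = 1\<close>, one of these is adjacent
  to \<open>?s\<close> or \<open>?r\<close>; for \<open>e = d = 1\<close> they are
  \<open>m + 3 - N\<close> and \<open>m + 3 - 2 * N\<close>, which exclude each other.\<close>

lemma grid_step:
  assumes "X m" "X (m + 2 + (N - 1) * e)" "X (m - 2 * (N - 1) - d)" "e \<in> {0, 1}" "d \<in> {0, 1}"
  shows "X (m + 2 + (N - 1) * e - 2 * (N - 1) - d)"
proof -
  let ?r = "m + 2 + (N - 1) * e" and ?s = "m - 2 * (N - 1) - d"
  note facts = cosnake_pred[OF assms(2)] snake_succ[OF assms(3)] not_adjacent[OF assms(2)]
    not_adjacent[OF assms(3)] not_adjacent(3)[of "m + 3 - 2 * N"]
  consider "e = 0" "d = 0" | "e = 1" "d = 0" | "e = 0" "d = 1" | "e = 1" "d = 1"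
    using assms(4,5) by auto
  then show ?thesis
    by cases (use facts in \<open>auto simp: algebra_simps\<close>)
qed

end

section \<open>The grid generated by one live entry\<close>

locale live_tape = tape +
  fixes z :: int
  assumes live_origin: "X z"
begin

text \<open>\<open>E\<close> counts the long steps among the first successor steps from
  \<open>z\<close>, and \<open>D\<close> the long steps among the first predecessor steps. Both are
  read off the axes of the grid only.\<close>

primrec E :: "nat \<Rightarrow> int" where
  "E 0 = 0"
| "E (Suc i) = E i + (if X (z + 2 * int i + (N - 1) * E i + 2) then 0 else 1)"

primrec D :: "nat \<Rightarrow> int" where
  "D 0 = 0"
| "D (Suc j) = D j + (if X (z - D j - 2 * (N - 1) * int j - 2 * N + 2) then 0 else 1)"

definition P :: "nat \<Rightarrow> nat \<Rightarrow> int" where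
  "P i j = z + 2 * int i - D j + (N - 1) * (E i - 2 * int j)"

lemma E_bounds: "0 \<le> E i" "E i \<le> int i"
  by (induction i) auto

lemma D_bounds: "0 \<le> D j" "D j \<le> int j"
  by (induction j) auto

text \<open>The axes are live by the choice of \<open>E\<close> and \<open>D\<close>;
  \<open>grid_step\<close> carries their increments to every other row and column.\<close>

lemma live_P: "X (P i j)"
proof (induction i arbitrary: j)
  case 0
  show ?case
  proof (induction j)
    case 0
    show ?case by (simp add: P_def live_origin)
  next
    case (Suc j)
    then show ?case using cosnake_pred[OF Suc] by (auto simp: P_def algebra_simps)
  qed
next
  case (Suc i)
  show ?case
  proof (induction j)
    case 0
    show ?case using snake_succ[OF Suc[of 0]] by (auto simp: P_def algebra_simps)
  next
    case (Suc j)
    have "X (P i j + 2 + (N - 1) * (E (Suc i) - E i) - 2 * (N - 1) - (D (Suc j) - D j))"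
    proof (rule grid_step)
      show "X (P i j)" by fact
      show "X (P i j + 2 + (N - 1) * (E (Suc i) - E i))"
        using Suc by (simp add: P_def algebra_simps)
      show "X (P i j - 2 * (N - 1) - (D (Suc j) - D j))"
        using \<open>\<And>j. X (P i j)\<close>[of "Suc j"] by (simp add: P_def algebra_simps)
    qed auto
    then show ?case by (simp add: P_def algebra_simps)
  qed
qed

text \<open>The increment of \<open>E\<close>, defined at \<open>j = 0\<close>, can be read off at
  any \<open>j\<close>, since \<open>P (Suc i) j\<close> is live and only one of the two successors
  can be.\<close>

lemma E_step: "E (Suc i) = E i + (if X (P i j + 2) then 0 else 1)"
proof -
  have "P (Suc i) j = P i j + 2 + (N - 1) * (E (Suc i) - E i)"
    by (simp add: P_def algebra_simps)
  moreover have "X (P i j + N + 1) \<longleftrightarrow> \<not> X (P i j + 2)"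
    by (rule snake_succ) (rule live_P)
  moreover have "E (Suc i) = E i \<or> E (Suc i) = E i + 1" by simp
  ultimately show ?thesis using live_P[of "Suc i" j]
    by (auto simp: algebra_simps simp del: E.simps)
qed

text \<open>For each \<open>j\<close> some \<open>i\<close> fits the first coordinate. Raising
  \<open>j\<close> by 1 adds 2 to the discrepancy \<open>f\<close> of the second coordinate and
  takes away at most 1, so \<open>f\<close> climbs by 1 or 2 and cannot jump over both 0 and
  1.\<close>

lemma P_near:
  assumes "0 \<le> p" "q \<le> 0"
  obtains i j where "p - (2 * int i - D j) \<in> {0, 1}" "q - (E i - 2 * int j) \<in> {0, 1}"
proof -
  define I where "I j = nat ((p + D j) div 2)" for j
  define f where "f j = q + 2 * int j - E (I j)" for j
  have I: "p - (2 * int (I j) - D j) \<in> {0, 1}" for j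
    using assms(1) D_bounds(1)[of j] unfolding I_def by auto
  have "I (Suc j) = I j \<or> I (Suc j) = Suc (I j)" for j
    using I[of j] I[of "Suc j"] by (auto split: if_splits)
  then have step: "f j + 1 \<le> f (Suc j) \<and> f (Suc j) \<le> f j + 2" for j
    unfolding f_def by (smt (verit) E.simps(2) of_nat_Suc)
  have "f 0 + int j \<le> f j" for j
    by (induction j) (use step in \<open>auto intro: order_trans\<close>, smt (verit) step)
  then have "0 \<le> f (nat (- f 0))" by (smt (verit) of_nat_0_le_iff nat_0_le)
  then have ex: "\<exists>j. 0 \<le> f j" ..
  define j where "j = (LEAST j. 0 \<le> f j)"
  have ge: "0 \<le> f j" unfolding j_def by (rule LeastI_ex[OF ex])
  have "f j \<le> 1"
  proof (cases j)
    case 0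
    then show ?thesis using assms(2) E_bounds(1)[of "I 0"] by (simp add: f_def)
  next
    case (Suc k)
    then have "\<not> 0 \<le> f k" unfolding j_def by (metis not_less_Least lessI)
    then show ?thesis using step[of k] Suc by simp
  qed
  then have "q - (E (I j) - 2 * int j) \<in> {0, 1}" using ge unfolding f_def by auto
  then show ?thesis using that I by blast
qed

text \<open>By \<open>P_near\<close> the position exceeds some grid point by 0, 1,
  \<open>N - 1\<close> or \<open>N\<close>; all but 0 would make it adjacent to a live
  entry.\<close>

lemma live_eq_P:
  assumes "X (z + p + (N - 1) * q)" "0 \<le> p" "q \<le> 0"
  obtains i j where "p = 2 * int i - D j" "q = E i - 2 * int j"
proof -
  obtain i j where ij: "p - (2 * int i - D j) \<in> {0, 1}" "q - (E i - 2 * int j) \<in> {0, 1}"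
    using P_near assms(2,3) by blast
  define r s where "r = p - (2 * int i - D j)" and "s = q - (E i - 2 * int j)"
  have "z + p + (N - 1) * q = P i j + r + (N - 1) * s"
    by (simp add: P_def r_def s_def algebra_simps)
  then have "X (P i j + r + (N - 1) * s)" using assms(1) by simp
  then have "r = 0 \<and> s = 0"
    using not_adjacent[OF live_P[of i j]] ij unfolding r_def[symmetric] s_def[symmetric]
    by (auto simp: algebra_simps)
  then show ?thesis using that unfolding r_def s_def by auto
qed

lemma live_in_P:
  assumes "X m"
  obtains i j where "m = P i j"
proof -
  \<comment> \<open>Adding \<open>k * (N - 1)\<close> to \<open>p\<close> and subtracting
    \<open>k\<close> from \<open>q\<close> keeps the position; this \<open>k\<close> is large enough
    to reach \<open>0 \<le> p\<close> and \<open>q \<le> 0\<close>.\<close>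
  define k where "k = \<bar>m - z\<bar>"
  have "k * 1 \<le> k * (N - 1)" using N_ge by (intro mult_left_mono) (auto simp: k_def)
  moreover have "- (m - z) \<le> k" by (simp add: k_def)
  ultimately have "0 \<le> m - z + k * (N - 1)" by linarith
  moreover have "X (z + (m - z + k * (N - 1)) + (N - 1) * (- k))" using assms by (simp add: algebra_simps)
  ultimately obtain i j where "m - z + k * (N - 1) = 2 * int i - D j" "- k = E i - 2 * int j"
    using live_eq_P[of "m - z + k * (N - 1)" "- k"] by (auto simp: k_def)
  then have "m = z + (2 * int i - D j) - k * (N - 1)" "k = - (E i - 2 * int j)" by auto
  then have "m = P i j" by (simp add: P_def algebra_simps)
  then show ?thesis by (rule that)
qed

section \<open>Periodicity of the grid and the bound on \<open>l\<close>\<close>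

lemma shift_bound:
  assumes "4 \<le> N" "0 < l" "l dvd N"
    and shift: "\<And>h. 0 \<le> h \<Longrightarrow> (\<And>m. X m \<Longrightarrow> X (m + h)) \<Longrightarrow> l dvd h"
  shows "4 * l \<le> N"
proof -
  \<comment> \<open>The coordinates \<open>N - 1\<close> and \<open>- 1\<close> describe
    \<open>z\<close> again, so \<open>P a b = z\<close>.\<close>
  have "X (z + (N - 1) + (N - 1) * (- 1))" using live_origin by simp
  then obtain a b where ab: "N - 1 = 2 * int a - D b" "- 1 = E a - 2 * int b"
    using live_eq_P[of "N - 1" "- 1"] N_ge by auto
  have P_return: "E (i + a) = E i + E a \<Longrightarrow> P (i + a) b = P i 0" for i
  proof -
    assume *: "E (i + a) = E i + E a"
    have "P (i + a) b = z + 2 * int i + (2 * int a - D b) + (N - 1) * (E i + (E a - 2 * int b))"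
      unfolding P_def * by (simp add: algebra_simps)
    then show ?thesis unfolding ab[symmetric] by (simp add: P_def algebra_simps)
  qed
  have E_add: "E (i + a) = E i + E a" for i
  proof (induction i)
    case (Suc i)
    \<comment> \<open>Both increments test the same entry of the tape, as
      \<open>P (i + a) b = P i 0\<close>.\<close>
    then show ?case using E_step[of "i + a" b] E_step[of i 0] P_return[OF Suc] by simp
  qed simp
  \<comment> \<open>The displacement from \<open>P i j\<close> to \<open>P (i + a) j\<close>,
    constant by \<open>E_add\<close>.\<close>
  define h where "h = 2 * int a + (N - 1) * E a"
  have "X (m + h)" if "X m" for m
  proof -
    obtain i j where "m = P i j" using live_in_P \<open>X m\<close> .
    moreover have "P i j + h = P (i + a) j" unfolding P_def h_def E_add by (simp add: algebra_simps)
    ultimately show ?thesis by (simp add: live_P)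
  qed
  moreover have "0 \<le> h" using E_bounds N_ge by (simp add: h_def)
  ultimately have "l dvd h" using shift by blast
  \<comment> \<open>Subtracting the two equations \<open>ab\<close> splits \<open>N\<close> into
    these two parts; \<open>N1\<close> is congruent to \<open>h\<close> modulo
    \<open>N\<close>.\<close>
  define N1 N2 where "N1 = 2 * int a - E a" and "N2 = 2 * int b - D b"
  have sum: "N = N1 + N2" using ab by (simp add: N1_def N2_def)
  have "N1 = h - N * E a" by (simp add: N1_def h_def algebra_simps)
  then have "l dvd N1" using \<open>l dvd h\<close> \<open>l dvd N\<close> by simp
  then have "l dvd N2" using \<open>l dvd N\<close> sum by (simp add: dvd_add_right_iff)
  obtain k1 k2 where k: "N1 = l * k1" "N2 = l * k2" using \<open>l dvd N1\<close> \<open>l dvd N2\<close> by (auto elim!: dvdE)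
  have b: "1 \<le> int b" using ab(2) E_bounds(1)[of a] by linarith
  have a: "E a = 2 * int b - 1" "E a \<le> int a" using ab(2) E_bounds by auto
  have "0 < N1" using a b unfolding N1_def by linarith
  have "0 < N2" using b D_bounds[of b] unfolding N2_def by linarith
  have pos: "0 < k1" "0 < k2" using k \<open>0 < N1\<close> \<open>0 < N2\<close> \<open>0 < l\<close> by (auto simp: zero_less_mult_iff)
  have "odd N1" unfolding N1_def a by simp
  \<comment> \<open>Here \<open>N2 \<le> 2 * int b = E a + 1\<close>, and
    \<open>E a \<le> N1\<close> because \<open>E a \<le> int a\<close>.\<close>
  have le: "N2 \<le> N1 + 1" using a D_bounds(1)[of b] unfolding N1_def N2_def by linarith
  have "4 \<le> k1 + k2"
  proof (rule ccontr)
    assume "\<not> 4 \<le> k1 + k2"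
    then consider "k1 = 1" "k2 = 1" | "k1 = 2" | "k1 = 1" "k2 = 2" using pos by linarith
    then show False
    proof cases
      case 1
      then have eq: "N2 = N1" using k by simp
      \<comment> \<open>Equality of \<open>N1\<close> and \<open>N2\<close> gives
        \<open>2 * int a - E a \<le> E a + 1\<close>, hence \<open>int a \<le> E a\<close>.\<close>
      then have "E a = int a" using \<open>odd N1\<close> a D_bounds(1)[of b] unfolding N1_def N2_def by presburger
      have full: "E i = int i" for i
      proof (induction i rule: less_induct)
        case (less i)
        show ?case
        proof (cases "i \<le> a")
          case True
          \<comment> \<open>Steps are at most 1, so a rise of \<open>a\<close> in \<open>a\<close>
            steps forces each of them to be 1.\<close>
          have "E (i + d) \<le> E i + int d" for d by (induction d) auto
          from this[of "a - i"] show ?thesis using True \<open>E a = int a\<close> E_bounds(2)[of i] by simp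
        next
          case False
          have "0 < a" using a b by linarith
          then have "E (i - a) = int (i - a)" using less False by simp
          then show ?thesis using E_add[of "i - a"] False \<open>E a = int a\<close> by simp
        qed
      qed
      have "X (m + (N + 1))" if "X m" for m
      proof -
        obtain i j where "m = P i j" using live_in_P \<open>X m\<close> .
        then have "m + (N + 1) = P (Suc i) j" by (simp add: P_def full algebra_simps del: E.simps)
        then show ?thesis by (simp add: live_P)
      qed
      then have "l dvd N + 1" using shift[of "N + 1"] N_ge by simp
      then have "l dvd 1" using \<open>l dvd N\<close> by (simp add: dvd_add_right_iff)
      then show False using \<open>0 < l\<close> 1 k sum \<open>4 \<le> N\<close> by simp
    next
      case 2
      then show False using \<open>odd N1\<close> k by simp
    next
      case 3
      \<comment> \<open>Here \<open>2 * l \<le> l + 1\<close>, so \<open>l = 1\<close> and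
        \<open>N = 3\<close>.\<close>
      then show False using le k sum \<open>4 \<le> N\<close> by simp
    qed
  qed
  then have "l * 4 \<le> l * (k1 + k2)" using \<open>0 < l\<close> by simp
  then show ?thesis using sum k by (simp add: algebra_simps)
qed

end

section \<open>Toggles\<close>

lemma indep_setsI:
  assumes "x \<in> {1..n} \<rightarrow>\<^sub>E {0, 1}" "\<And>i. i \<in> {1..n} \<Longrightarrow> \<not> (x i = 1 \<and> x (cyc n (i + 1)) = 1)"
  shows "x \<in> indep_sets n"
  using assms unfolding indep_sets_def cycle_edges_def by (auto simp: doubleton_eq_iff)

lemma cyc_in: "0 < n \<Longrightarrow> cyc n j \<in> {1..n}"
  by (auto simp: cyc_def Suc_le_eq less_imp_le)

lemma indep_setsD:
  assumes "x \<in> indep_sets n" "i \<in> {1..n}"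
  shows "\<not> (x i = 1 \<and> x (cyc n (i + 1)) = 1)"
proof -
  have "cyc n (i + 1) \<in> {1..n}" using assms(2) by (intro cyc_in) auto
  then show ?thesis using assms unfolding indep_sets_def cycle_edges_def by blast
qed

definition prev :: "nat \<Rightarrow> nat \<Rightarrow> nat" where
  "prev n k = (if k = 1 then n else k - 1)"

definition succ :: "nat \<Rightarrow> nat \<Rightarrow> nat" where
  "succ n k = (if k = n then 1 else k + 1)"

lemma indep_sets_iff:
  "x \<in> indep_sets n \<longleftrightarrow> x \<in> {1..n} \<rightarrow>\<^sub>E {0, 1} \<and> (\<forall>i\<in>{1..n}. \<not> (x i = 1 \<and> x (succ n i) = 1))"
proof -
  have "cyc n (i + 1) = succ n i" if "i \<in> {1..n}" for i
    using that by (cases "n = 1"; cases "i = n") (auto simp: succ_def cyc_def mod_Suc)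
  then have "(\<forall>i\<in>{1..n}. \<not> (x i = 1 \<and> x (succ n i) = 1))
      \<longleftrightarrow> (\<forall>i\<in>{1..n}. \<not> (x i = 1 \<and> x (cyc n (i + 1)) = 1))"
    by simp
  moreover have "x \<in> indep_sets n \<Longrightarrow> x \<in> {1..n} \<rightarrow>\<^sub>E {0, 1}"
    by (simp add: indep_sets_def)
  ultimately show ?thesis using indep_setsI[of x n] indep_setsD[of x n] by blast
qed

text \<open>Only the two edges at \<open>k\<close> are affected, and \<open>2 \<le> n\<close> keeps
  the neighbours of \<open>k\<close> distinct from \<open>k\<close>, so the update does not touch
  them.\<close>

lemma update_indep_iff:
  assumes "2 \<le> n" "x \<in> indep_sets n" "k \<in> {1..n}"
  shows "x(k := 1) \<in> indep_sets n \<longleftrightarrow> x (prev n k) \<noteq> 1 \<and> x (succ n k) \<noteq> 1"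
proof
  assume "x(k := 1) \<in> indep_sets n"
  then have *: "\<not> ((x(k := 1)) i = 1 \<and> (x(k := 1)) (succ n i) = 1)" if "i \<in> {1..n}" for i
    using that unfolding indep_sets_iff by blast
  have "prev n k \<in> {1..n}" "succ n (prev n k) = k" "prev n k \<noteq> k" "succ n k \<noteq> k"
    using assms by (auto simp: prev_def succ_def)
  then show "x (prev n k) \<noteq> 1 \<and> x (succ n k) \<noteq> 1"
    using *[of "prev n k"] *[OF assms(3)] by simp
next
  assume *: "x (prev n k) \<noteq> 1 \<and> x (succ n k) \<noteq> 1"
  have x: "x \<in> {1..n} \<rightarrow>\<^sub>E {0, 1}" "\<And>i. i \<in> {1..n} \<Longrightarrow> \<not> (x i = 1 \<and> x (succ n i) = 1)"
    using assms(2) unfolding indep_sets_iff by auto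
  have "\<not> ((x(k := 1)) i = 1 \<and> (x(k := 1)) (succ n i) = 1)" if "i \<in> {1..n}" for i
  proof -
    have "prev n (succ n i) = i" "succ n i \<noteq> i"
      using that assms(1) by (auto simp: prev_def succ_def)
    then show ?thesis using * x(2)[OF that] by (cases "succ n i = k"; cases "i = k") auto
  qed
  moreover have "x(k := 1) \<in> {1..n} \<rightarrow>\<^sub>E {0, 1}"
    using x(1) assms(3) by (auto simp: PiE_iff extensional_def)
  ultimately show "x(k := 1) \<in> indep_sets n" unfolding indep_sets_iff by blast
qed

lemma toggle_indep:
  assumes "x \<in> indep_sets n" "k \<in> {1..n}"
  shows "toggle n k x \<in> indep_sets n"
proof -
  have "x(k := 0) \<in> {1..n} \<rightarrow>\<^sub>E {0, 1}"
    using assms by (auto simp: indep_sets_def PiE_iff extensional_def)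
  moreover have "\<not> ((x(k := 0)) i = 1 \<and> (x(k := 0)) (succ n i) = 1)" if "i \<in> {1..n}" for i
    using assms(1) that unfolding indep_sets_iff by simp
  ultimately have "x(k := 0) \<in> indep_sets n" unfolding indep_sets_iff by blast
  then show ?thesis using assms(1) by (simp add: toggle_def)
qed

lemma toggle_toggle:
  assumes "x \<in> indep_sets n" "k \<in> {1..n}"
  shows "toggle n k (toggle n k x) = x"
proof (cases "x k = 1")
  case True
  then have "x(k := 1) = x" by auto
  then show ?thesis using True assms(1) by (simp add: toggle_def)
next
  case False
  then have "x k = 0" using assms by (auto simp: indep_sets_def)
  then have "x(k := 0) = x" by auto
  then show ?thesis using False by (simp add: toggle_def)
qed

lemma toggle_eq_1_iff:
  assumes "2 \<le> n" "x \<in> indep_sets n" "k \<in> {1..n}"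
  shows "toggle n k x k = 1 \<longleftrightarrow> x k \<noteq> 1 \<and> x (prev n k) \<noteq> 1 \<and> x (succ n k) \<noteq> 1"
  using update_indep_iff[OF assms] unfolding toggle_def by auto

lemma toggle_other: "j \<noteq> k \<Longrightarrow> toggle n k x j = x j"
  by (simp add: toggle_def)

text \<open>The sweep stopped after vertex \<open>k\<close>: the vector that the toggle at
  \<open>k + 1\<close> sees, with \<open>k\<close> available for induction.\<close>

definition partial_tau :: "nat \<Rightarrow> nat \<Rightarrow> (nat \<Rightarrow> nat) \<Rightarrow> nat \<Rightarrow> nat" where
  "partial_tau n k x = fold (toggle n) [1..<Suc k] x"

lemma partial_tau_0: "partial_tau n 0 x = x"
  by (simp add: partial_tau_def)

lemma partial_tau_Suc: "partial_tau n (Suc k) x = toggle n (Suc k) (partial_tau n k x)"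
  by (simp add: partial_tau_def)

lemma tau_eq_partial_tau: "tau n x = partial_tau n n x"
  by (simp add: tau_def partial_tau_def)

lemma partial_tau_indep: "x \<in> indep_sets n \<Longrightarrow> k \<le> n \<Longrightarrow> partial_tau n k x \<in> indep_sets n"
  by (induction k) (auto simp: partial_tau_0 partial_tau_Suc intro!: toggle_indep)

text \<open>The last toggle is an involution on independent sets, so it can be undone.\<close>

lemma inj_on_partial_tau: "k \<le> n \<Longrightarrow> inj_on (partial_tau n k) (indep_sets n)"
proof (induction k)
  case (Suc k)
  show ?case
  proof (rule inj_onI)
    fix x y
    assume *: "x \<in> indep_sets n" "y \<in> indep_sets n" "partial_tau n (Suc k) x = partial_tau n (Suc k) y"
    have undo: "toggle n (Suc k) (partial_tau n (Suc k) w) = partial_tau n k w" if "w \<in> indep_sets n" for w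
      unfolding partial_tau_Suc using that Suc.prems
      by (intro toggle_toggle partial_tau_indep) auto
    have "partial_tau n k x = partial_tau n k y"
      using undo[OF *(1)] undo[OF *(2)] unfolding *(3) by (rule box_equals[OF refl])
    then show "x = y" using inj_onD[OF Suc.IH] Suc.prems *(1,2) by simp
  qed
qed (simp add: partial_tau_0 inj_on_def)

lemma partial_tau_above: "k < j \<Longrightarrow> partial_tau n k x j = x j"
  by (induction k) (auto simp: partial_tau_0 partial_tau_Suc toggle_other)

lemma partial_tau_stable:
  "j \<le> k \<Longrightarrow> partial_tau n k x j = partial_tau n j x j"
  by (induction k rule: dec_induct) (auto simp: partial_tau_Suc toggle_other)

text \<open>The toggle at \<open>k\<close> sees new values before \<open>k\<close> and old ones
  after it, except across the seam: at \<open>k = 1\<close> vertex \<open>n\<close> is still old, at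
  \<open>k = n\<close> vertex 1 is already new. On the concatenated rows this becomes the uniform
  rule \<open>rec\<close>.\<close>

lemma tau_eq_1_iff:
  assumes "2 \<le> n" "x \<in> indep_sets n" "k \<in> {1..n}"
  shows "tau n x k = 1 \<longleftrightarrow> x k \<noteq> 1
    \<and> (if k = 1 then x n else tau n x (k - 1)) \<noteq> 1
    \<and> (if k = n then tau n x 1 else x (k + 1)) \<noteq> 1"
proof -
  obtain l where l: "k = Suc l" "l < n" using assms(3) by (cases k) auto
  define y where "y = partial_tau n l x"
  have "y \<in> indep_sets n" unfolding y_def using assms(2) l by (intro partial_tau_indep) auto
  have "tau n x k = toggle n k y k"
    using partial_tau_stable[of k n n x] assms(3) unfolding tau_eq_partial_tau y_def l(1)
    by (simp add: partial_tau_Suc)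
  moreover have "y k = x k" unfolding y_def l(1) by (rule partial_tau_above) simp
  moreover have "y (prev n k) = (if k = 1 then x n else tau n x (k - 1))"
    using partial_tau_stable[of l n n x] l assms(1) unfolding prev_def y_def tau_eq_partial_tau
    by (auto intro: partial_tau_above)
  moreover have "y (succ n k) = (if k = n then tau n x 1 else x (k + 1))"
    using partial_tau_stable[of 1 n n x] partial_tau_stable[of 1 l n x] l assms(1)
    unfolding succ_def y_def tau_eq_partial_tau by (auto intro: partial_tau_above)
  ultimately show ?thesis using toggle_eq_1_iff[OF assms(1) \<open>y \<in> _\<close> assms(3)] by simp
qed

section \<open>Periodicity of orbits\<close>

lemma tau_indep: "x \<in> indep_sets n \<Longrightarrow> tau n x \<in> indep_sets n"
  by (simp add: tau_eq_partial_tau partial_tau_indep)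

lemma tau_funpow_indep: "x \<in> indep_sets n \<Longrightarrow> (tau n ^^ i) x \<in> indep_sets n"
  by (induction i) (auto intro: tau_indep)

lemma finite_indep_sets: "finite (indep_sets n)"
  by (rule finite_subset[of _ "{1..n} \<rightarrow>\<^sub>E {0, 1}"]) (auto simp: indep_sets_def intro!: finite_PiE)

text \<open>Two iterates coincide because there are finitely many independent sets; injectivity
  cancels common iterates until one of them is \<open>x\<close>.\<close>

lemma tau_returns:
  assumes "x \<in> indep_sets n"
  obtains m where "0 < m" "(tau n ^^ m) x = x"
proof -
  have inj: "inj_on (tau n) (indep_sets n)"
    using inj_on_partial_tau[of n n] by (simp add: tau_eq_partial_tau[abs_def])
  have "\<not> inj (\<lambda>i. (tau n ^^ i) x)"
    using finite_subset[OF _ finite_indep_sets[of n], of "range (\<lambda>i. (tau n ^^ i) x)"]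
      tau_funpow_indep[OF assms] 
      finite_imageD[of _ UNIV] infinite_UNIV_nat by blast
  then obtain i j where "i < j" "(tau n ^^ i) x = (tau n ^^ j) x"
    unfolding inj_def by (metis linorder_neqE_nat)
  then have "\<exists>d>0. (tau n ^^ d) x = x"
  proof (induction i arbitrary: j)
    case (Suc i)
    then obtain l where l: "j = Suc l" by (cases j) auto
    then have "(tau n ^^ i) x = (tau n ^^ l) x"
      using Suc.prems inj tau_funpow_indep[OF assms] by (auto dest: inj_onD)
    then show ?case using Suc l by auto
  qed auto
  then show ?thesis using that by blast
qed

lemma scroll_period_returns:
  assumes "x \<in> indep_sets n"
  shows "0 < scroll_period (scroll n x)" "(tau n ^^ scroll_period (scroll n x)) x = x"
proof -
  obtain m where "0 < m" "(tau n ^^ m) x = x" using tau_returns[OF assms] .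
  then have "0 < m \<and> scroll n x (int m) = scroll n x 0" by (simp add: scroll_def)
  from LeastI[of "\<lambda>m. 0 < m \<and> scroll n x (int m) = scroll n x 0", OF this]
  show "0 < scroll_period (scroll n x)" "(tau n ^^ scroll_period (scroll n x)) x = x"
    by (auto simp: scroll_period_def scroll_def)
qed

section \<open>Sum vectors\<close>

text \<open>\<open>V\<close> unrolls the cyclic word to all positive indices. If a shift by
  \<open>h\<close> preserves \<open>V\<close>, so does its remainder modulo the least period, which
  by minimality is 0.\<close>

lemma cyclic_word_period_dvd:
  fixes V :: "nat \<Rightarrow> 'a"
  assumes "0 < n" "\<And>j. 1 \<le> j \<Longrightarrow> V (j + n) = V j" "\<And>j. j \<in> {1..n} \<Longrightarrow> w j = V j"
  shows "0 < cyclic_word_period n w"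
    and "(\<And>j. 1 \<le> j \<Longrightarrow> V (j + h) = V j) \<Longrightarrow> cyclic_word_period n w dvd h"
proof -
  have mult: "V (j + d * p) = V j" if "\<And>j. 1 \<le> j \<Longrightarrow> V (j + p) = V j" "1 \<le> j" for p d j
  proof (induction d)
    case (Suc d)
    then show ?case using that(1)[of "j + d * p"] that(2) by (simp add: algebra_simps)
  qed simp
  have cyc_decomp: "\<exists>d. j = cyc n j + d * n" if "1 \<le> j" for j
  proof (cases "j mod n = 0")
    case True
    then obtain d where d: "j = n * d" by auto
    with that obtain d' where "d = Suc d'" by (cases d) auto
    \<comment> \<open>Multiples of \<open>n\<close> are represented by \<open>n\<close> and not by
      0, so one turn fewer is split off.\<close>
    then have "j = cyc n j + d' * n" using True d by (simp add: cyc_def)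
    then show ?thesis ..
  next
    case False
    then have "j = cyc n j + (j div n) * n" by (simp add: cyc_def)
    then show ?thesis ..
  qed
  have cyc_ge: "1 \<le> cyc n j" for j using cyc_in[OF assms(1), of j] by simp
  have V_cyc: "V (cyc n j + p) = V (j + p)" if j: "1 \<le> j" for j p
  proof -
    obtain d where d: "j = cyc n j + d * n" using cyc_decomp[OF j] ..
    have "V ((cyc n j + p) + d * n) = V (cyc n j + p)"
      by (rule mult[OF assms(2)]) (use cyc_ge[of j] in auto)
    moreover have "j + p = (cyc n j + p) + d * n" by (subst d) simp
    ultimately show ?thesis by (simp only:)
  qed
  have w_cyc: "w (cyc n j) = V j" if "1 \<le> j" for j
    using assms(3)[OF cyc_in[OF assms(1), of j]] V_cyc[OF that, of 0] by simp
  let ?per = "\<lambda>p. 0 < p \<and> (\<forall>j\<in>{1..n}. w (cyc n (j + p)) = w j)"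
  have per_iff: "?per p \<longleftrightarrow> 0 < p \<and> (\<forall>j\<ge>1. V (j + p) = V j)" for p
  proof -
    have "(\<forall>j\<in>{1..n}. w (cyc n (j + p)) = w j) \<longleftrightarrow> (\<forall>j\<in>{1..n}. V (j + p) = V j)"
    proof (rule ball_cong[OF refl])
      fix j assume j: "j \<in> {1..n}"
      then have "w (cyc n (j + p)) = V (j + p)" by (intro w_cyc) simp
      then show "w (cyc n (j + p)) = w j \<longleftrightarrow> V (j + p) = V j" by (simp only: assms(3)[OF j])
    qed
    also have "\<dots> \<longleftrightarrow> (\<forall>j\<ge>1. V (j + p) = V j)"
    proof (intro iffI allI impI)
      fix j :: nat assume *: "\<forall>j\<in>{1..n}. V (j + p) = V j" and j: "1 \<le> j"
      then have "V (cyc n j + p) = V (cyc n j)" using cyc_in[OF assms(1)] by blast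
      then show "V (j + p) = V j" using V_cyc[OF j, of p] V_cyc[OF j, of 0] by simp
    qed simp
    finally show ?thesis by blast
  qed
  let ?Q = "\<lambda>p. 0 < p \<and> (\<forall>j\<ge>1. V (j + p) = V j)"
  define l where "l = cyclic_word_period n w"
  have l_eq: "l = (LEAST p. ?Q p)"
    unfolding l_def cyclic_word_period_def per_iff by (rule refl)
  have "?Q n" using assms(1,2) by blast
  then have "?Q l" unfolding l_eq by (rule LeastI[of ?Q])
  then have l: "0 < l" "\<And>j. 1 \<le> j \<Longrightarrow> V (j + l) = V j" by blast+
  show "0 < cyclic_word_period n w" using l(1) unfolding l_def .
  assume h: "\<And>j. 1 \<le> j \<Longrightarrow> V (j + h) = V j"
  have rem: "V (j + h mod l) = V j" if j: "1 \<le> j" for j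
  proof -
    have "V (j + h mod l + (h div l) * l) = V (j + h mod l)"
      by (rule mult[OF l(2)]) (use j in auto)
    moreover have "j + h mod l + (h div l) * l = j + h" by simp
    ultimately show ?thesis using h[OF j] by (simp only:)
  qed
  have "\<not> ?Q (h mod l)"
    by (rule not_less_Least) (unfold l_eq[symmetric], rule mod_less_divisor[OF l(1)])
  then have "h mod l = 0" using rem by simp
  then show "cyclic_word_period n w dvd h" unfolding l_def[symmetric] by (rule mod_0_imp_dvd)
qed

section \<open>The scroll read as a tape\<close>

theorem theorem5p5:
  fixes n lam :: nat and x :: "nat \<Rightarrow> nat"
  assumes "4 \<le> n"
    and "x \<in> indep_sets n"
    and "cyclic_word_period n (sum_vector n (scroll n x)) = lam"
  shows "lam dvd n \<and> 4 * lam \<le> n"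
proof -
  define T where "T = scroll_period (scroll n x)"
  have T: "0 < T" "(tau n ^^ T) x = x"
    using scroll_period_returns[OF assms(2)] by (simp_all add: T_def)
  \<comment> \<open>Reduction modulo \<open>T\<close> extends the forward orbit to a two-sided
    sequence.\<close>
  define row where "row i = (tau n ^^ nat (i mod int T)) x" for i :: int
  have row_indep: "row i \<in> indep_sets n" for i
    unfolding row_def by (rule tau_funpow_indep[OF assms(2)])
  have row_Suc: "row (i + 1) = tau n (row i)" for i
  proof (cases "i mod int T = int T - 1")
    case True
    then have "(i + 1) mod int T = 0" by (metis diff_add_cancel mod_add_left_eq mod_self)
    then have "row (i + 1) = x" by (simp add: row_def)
    moreover have "Suc (nat (i mod int T)) = T" using True T(1) by simp
    then have "tau n (row i) = x" unfolding row_def using T(2) by (metis comp_apply funpow.simps(2))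
    ultimately show ?thesis by simp
  next
    case False
    then have "i mod int T + 1 < int T"
      using T(1) pos_mod_bound[of "int T" i] by linarith
    then have "(i mod int T + 1) mod int T = i mod int T + 1"
      using T(1) by (intro mod_pos_pos_trivial) auto
    then have "(i + 1) mod int T = i mod int T + 1" by (simp only: mod_add_left_eq)
    then show ?thesis using T(1) by (simp add: row_def nat_add_distrib)
  qed
  have row_T: "row (i + int T) = row i" for i by (simp add: row_def)
  \<comment> \<open>Column \<open>j\<close> of row \<open>i\<close> sits at
    \<open>i * n + j\<close>; columns start at 1, hence \<open>m - 1\<close>.\<close>
  define X where "X m \<longleftrightarrow> row ((m - 1) div int n) (nat ((m - 1) mod int n) + 1) = 1" for m
  have X_entry: "X (i * int n + int j) \<longleftrightarrow> row i j = 1" if "j \<in> {1..n}" for i j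
  proof -
    have "(i * int n + int j - 1) div int n = i" "(i * int n + int j - 1) mod int n = int j - 1"
      using that by (auto intro!: int_div_pos_eq int_mod_pos_eq)
    then show ?thesis using that by (simp add: X_def nat_diff_distrib)
  qed
  have entry: "\<exists>i. \<exists>j\<in>{1..n}. m = i * int n + int j" for m
    using assms(1) by (intro exI[of _ "(m - 1) div int n"] bexI[of _ "nat ((m - 1) mod int n) + 1"])
      (auto simp: Suc_le_eq nat_less_iff)
  interpret tape "int n" X
  proof
    show "2 \<le> int n" using assms(1) by simp
    fix m
    obtain i j where ij: "m = (i + 1) * int n + int j" "j \<in> {1..n}"
      using entry[of "m - int n"] by (auto simp: algebra_simps)
    have "X m \<longleftrightarrow> tau n (row i) j = 1" using X_entry[OF ij(2), of "i + 1"] by (simp add: ij(1) row_Suc)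
    moreover have "X (m - int n) \<longleftrightarrow> row i j = 1"
      using X_entry[OF ij(2), of i] by (simp add: ij(1) algebra_simps)
    moreover have "X (m - 1) \<longleftrightarrow> (if j = 1 then row i n else tau n (row i) (j - 1)) = 1"
    proof (cases "j = 1")
      case True
      then show ?thesis using X_entry[of n i] ij(2) by (auto simp: ij(1) algebra_simps)
    next
      case False
      then have "j - 1 \<in> {1..n}" "int (j - 1) = int j - 1" using ij(2) by auto
      then show ?thesis using X_entry[of "j - 1" "i + 1", unfolded row_Suc] False
        by (simp add: ij(1) algebra_simps)
    qed
    moreover have "X (m - int n + 1) \<longleftrightarrow> (if j = n then tau n (row i) 1 else row i (j + 1)) = 1"
      using X_entry[of 1 "i + 1", unfolded row_Suc] X_entry[of "j + 1" i] ij(2)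
      by (cases "j = n") (auto simp: ij(1) algebra_simps)
    ultimately show "X m \<longleftrightarrow> \<not> X (m - int n) \<and> \<not> X (m - int n + 1) \<and> \<not> X (m - 1)"
      using tau_eq_1_iff[OF _ row_indep ij(2)] assms(1) by (simp only: ) auto
  qed
  \<comment> \<open>If position 0 is dead, one of the three entries that its recurrence reads is
    live.\<close>
  obtain z where "X z" using rec[of 0] by blast
  then interpret live_tape "int n" X z by unfold_locales
  have X_period: "X (m + int d * (int T * int n)) \<longleftrightarrow> X m" for m d
  proof (induction d)
    case (Suc d)
    obtain i j where ij: "m + int d * (int T * int n) = i * int n + int j" "j \<in> {1..n}" using entry by blast
    have "m + int (Suc d) * (int T * int n) = (i + int T) * int n + int j"
      using ij(1) by (simp add: algebra_simps)
    then show ?case using Suc ij X_entry[OF ij(2)] by (simp add: row_T)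
  qed simp
  \<comment> \<open>For \<open>j\<close> beyond \<open>n\<close> the positions run on into later
    rows, so adding \<open>n\<close> to \<open>j\<close> moves the window of \<open>T\<close> rows
    down by one, which periodicity does not notice.\<close>
  define V where "V j = (\<Sum>i<T. of_bool (X (int i * int n + int j)) :: nat)" for j
  have V_sum: "sum_vector n (scroll n x) j = V j" if "j \<in> {1..n}" for j
  proof -
    have "(tau n ^^ i) x j = of_bool (X (int i * int n + int j))" if "i < T" for i
    proof -
      have "row (int i) = (tau n ^^ i) x" using that by (simp add: row_def)
      moreover have "row (int i) j \<in> {0, 1}"
        using row_indep[of "int i"] \<open>j \<in> {1..n}\<close> unfolding indep_sets_iff by blast
      ultimately show ?thesis using X_entry[OF \<open>j \<in> {1..n}\<close>, of "int i"] by auto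
    qed
    then show ?thesis using that by (simp add: sum_vector_def scroll_def V_def flip: T_def)
  qed
  have V_n: "V (j + n) = V j" for j
  proof -
    let ?f = "\<lambda>i. of_bool (X (int i * int n + int j)) :: nat"
    have "V (j + n) = (\<Sum>i<T. ?f (Suc i))" by (simp add: V_def algebra_simps)
    also have "\<dots> + ?f 0 = (\<Sum>i<T. ?f i) + ?f T"
      using sum.lessThan_Suc_shift[of ?f T] by simp
    also have "?f T = ?f 0" using X_period[of "int j" 1] by (simp add: algebra_simps)
    finally show ?thesis by (simp add: V_def)
  qed
  have V_shift: "V (j + nat h) = V j" if "0 \<le> h" and h: "\<And>m. X m \<Longrightarrow> X (m + h)" for j h
  proof -
    have iter: "X (m + int d * h)" if "X m" for m d
    proof (induction d)
      case (Suc d)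
      then show ?case using h[OF Suc] by (simp add: algebra_simps)
    qed (use that in simp)
    have "X (m + h) \<longleftrightarrow> X m" for m
    proof
      assume "X (m + h)"
      \<comment> \<open>After \<open>T * n\<close> shifts by \<open>h\<close> in all, the
        displacement is a multiple of the period \<open>T * n\<close> of the tape, so liveness
        returns to \<open>m\<close>.\<close>
      then have "X (m + h + int (T * n - 1) * h)" by (rule iter)
      moreover have "m + h + int (T * n - 1) * h = m + int (nat h) * (int T * int n)"
        using \<open>0 \<le> h\<close> T(1) assms(1) by (simp add: of_nat_diff Suc_le_eq algebra_simps)
      ultimately show "X m" by (simp only: X_period)
    qed (rule h)
    moreover have "int i * int n + int (j + nat h) = int i * int n + int j + h" for i
      using \<open>0 \<le> h\<close> by simp
    ultimately show ?thesis unfolding V_def by (simp only:)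
  qed
  have n: "0 < n" using assms(1) by simp
  have "0 < lam" unfolding assms(3)[symmetric]
    by (rule cyclic_word_period_dvd(1)[where V = V]) (auto simp: n V_n V_sum)
  have lam_dvd: "lam dvd h" if "\<And>j. V (j + h) = V j" for h
    unfolding assms(3)[symmetric]
    by (rule cyclic_word_period_dvd(2)[where V = V]) (auto simp: n V_n V_sum that)
  then have "lam dvd n" using V_n .
  moreover have "4 * int lam \<le> int n"
  proof (rule shift_bound)
    fix h :: int assume h: "0 \<le> h" "\<And>m. X m \<Longrightarrow> X (m + h)"
    have "lam dvd nat h" by (rule lam_dvd) (rule V_shift[OF h])
    then show "int lam dvd h" using h(1) by (metis int_dvd_int_iff nat_0_le)
  qed (use assms(1) \<open>0 < lam\<close> \<open>lam dvd n\<close> in auto)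
  ultimately show ?thesis by simp
qed

end
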